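(* a) The degenerate quadruple $S_{3,4}$ can be unitarized with the character $\chi=(a_0;a_1,a_2,a_3,a_4)$ if $$a_1+a_2>a_3+a_4,\quad a_1<a_2+a_3+a_4,\quad a_2<a_1+a_3+a_4,\quad 2a_0=a_1+a_2+a_3+a_4,\quad a_i>0.$$ b) Every nondegenerate quadruple $S_\mu$, $\mu\in\mathbb{C}\setminus\{0,1\}$, can be unitarized with the character $\chi=(a_0;a_1,a_2,a_3,a_4)$ if and only if $$2a_i<\sum_{j=1}^4a_j,\quad i=1,\ldots,4,\qquad 2a_0=\sum_{j=1}^4a_j,\qquad 0<a_i<a_0,\quad i=1,\ldots,4.$$
   Context: Let $e_1,e_2$ be a basis of $\mathbb{C}^2$, and let $\langle v\rangle$ denote the linear span of $v$. Define the quadruples of subspaces of $\mathbb{C}^2$ $$S_\mu=(\mathbb{C}^2;\langle e_1\rangle,\langle e_2\rangle,\langle e_1+\mu e_2\rangle,\langle e_1+e_2\rangle),\quad \mu\in\mathbb{C}\setminus\{0,1\},$$ $$S_{3,4}=(\mathbb{C}^2;\langle e_1\rangle,\langle e_2\rangle,\langle e_1+e_2\rangle,\langle e_1+e_2\rangle).$$ The $S_\mu$ are called nondegenerate and $S_{3,4}$ degenerate. A character is a tuple $\chi=(a_0;a_1,a_2,a_3,a_4)$ of real numbers with $a_0\ge 0$ and $a_k>0$ for $1\le k\le 4$. A quadruple $(V;V_1,V_2,V_3,V_4)$ of subspaces of a finite dimensional complex linear space $V$ can be unitarized with the character $\chi$ if $V$ can be endowed with a Hermitian scalar product such that $\sum_{k=1}^4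 a_kP_k=a_0I$, where $P_k$ is the orthogonal projection of $V$ onto $V_k$ with respect to this scalar product. *)

theory Defs
  imports "HOL-Analysis.Analysis"
begin

definition hermitian_scalar_product :: "(complex^'n \<Rightarrow> complex^'n \<Rightarrow> complex) \<Rightarrow> bool" where
  "hermitian_scalar_product B \<longleftrightarrow>
     (\<forall>x y z. B (x + y) z = B x z + B y z) \<and>
     (\<forall>c x y. B (c *s x) y = c * B x y) \<and>
     (\<forall>x y. B y x = cnj (B x y)) \<and>
     (\<forall>x. x \<noteq> 0 \<longrightarrow> 0 < Re (B x x))"

definition orthogonal_projection ::
  "(complex^'n \<Rightarrow> complex^'n \<Rightarrow> complex) \<Rightarrow> (complex^'n) set \<Rightarrow> (complex^'n \<Rightarrow> complex^'n) \<Rightarrow> bool" where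
  "orthogonal_projection B W P \<longleftrightarrow>
     vec.subspace W \<and> (\<forall>x. P x \<in> W \<and> (\<forall>w\<in>W. B (x - P x) w = 0))"

(* The tuple (a_0; a_1, ..., a_4) is the restriction of a to {0..4}. *)
definition character :: "(nat \<Rightarrow> real) \<Rightarrow> bool" where
  "character a \<longleftrightarrow> 0 \<le> a 0 \<and> (\<forall>k\<in>{1..4}. 0 < a k)"

(* The ambient space V of a quadruple (V; V_1, ..., V_4) is the whole type; only the
   values of the indexing function at 1, ..., 4 matter. *)
definition unitarizable :: "(nat \<Rightarrow> (complex^'n) set) \<Rightarrow> (nat \<Rightarrow> real) \<Rightarrow> bool" where
  "unitarizable S a \<longleftrightarrow>
     (\<exists>B P. hermitian_scalar_product B \<and>
        (\<forall>k\<in>{1..4}. orthogonal_projection B (S k) (P k)) \<and>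
        (\<forall>x. (\<Sum>k=1..4. complex_of_real (a k) *s P k x) = complex_of_real (a 0) *s x))"

(* Distinctness is needed: if e1 = e2, the set {e1, e2} collapses to a singleton. *)
definition basis2 :: "complex^2 \<Rightarrow> complex^2 \<Rightarrow> bool" where
  "basis2 e1 e2 \<longleftrightarrow> e1 \<noteq> e2 \<and> vec.independent {e1, e2} \<and> vec.span {e1, e2} = UNIV"

definition S_nondegenerate :: "complex^2 \<Rightarrow> complex^2 \<Rightarrow> complex \<Rightarrow> nat \<Rightarrow> (complex^2) set" where
  "S_nondegenerate e1 e2 \<mu> = (\<lambda>_. {0})
     (1 := vec.span {e1}, 2 := vec.span {e2}, 3 := vec.span {e1 + \<mu> *s e2}, 4 := vec.span {e1 + e2})"

definition S_34 :: "complex^2 \<Rightarrow> complex^2 \<Rightarrow> nat \<Rightarrow> (complex^2) set" where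
  "S_34 e1 e2 = (\<lambda>_. {0})
     (1 := vec.span {e1}, 2 := vec.span {e2}, 3 := vec.span {e1 + e2}, 4 := vec.span {e1 + e2})"

end

theory Submission
  imports Defs
begin

text \<open>
  Up to a positive factor, a Hermitian scalar product on a plane with basis \<open>e1, e2\<close> is
  \<open>(x, y) \<mapsto> u x * cnj (u y) + t\<^sup>2 * q x * cnj (q y)\<close> with \<open>u x = p x + z * q x\<close>, where \<open>p, q\<close> are
  the coordinates and \<open>(z, t)\<close> ranges over the upper half-space \<open>t > 0\<close>, that is, hyperbolic
  3-space. Lines in the plane are the points of its sphere at infinity: the span of
  \<open>e2 - c *s e1\<close> is the boundary point \<open>c\<close>, the span of \<open>e1\<close> is the point \<open>\<infinity>\<close>. The
  unitarization problem asks for an interior point that sees the weighted boundary points in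
  balance (their conformal barycentre).

  Such a point is found by minimising the weighted sum of logarithmic (Busemann) distances to the
  boundary points, the Kempf--Ness function of the configuration. It tends to infinity at each end
  of hyperbolic space exactly when no boundary point carries half of the total weight or more
  (\<open>stable_potential_attains_minimum\<close>), and the vanishing of its derivative at a minimum is the
  equation between the projections (\<open>ex_balanced_point\<close>, \<open>unitarizable_of_stable_slopes\<close>).
  The degenerate quadruple is the case of three boundary points, one of them with weight
  \<open>a 3 + a 4\<close>; the given inequalities are the stability conditions in both cases.

  Conversely, taking traces in \<open>\<Sum> a\<^sub>k P\<^sub>k = a\<^sub>0 I\<close> gives \<open>2 a\<^sub>0 = \<Sum> a\<^sub>k\<close>
  (\<open>unitarizable_lines_trace\<close>). Evaluating the quadratic form at a vector of the \<open>i\<close>-th line gives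
  \<open>a\<^sub>i < a\<^sub>0\<close>, since the other projections contribute nonnegatively and cannot all vanish there
  (\<open>unitarizable_weight_less\<close>).
\<close>

section \<open>The balanced point of a stable weighted configuration\<close>

text \<open>
  The squared Euclidean distance in the half-space from \<open>(z, t)\<close> to the boundary point \<open>(c, 0)\<close>;
  also the squared length of \<open>e2 - c *s e1\<close> in the scalar product with parameter \<open>(z, t)\<close>.
\<close>

definition sqdist :: "complex \<Rightarrow> complex \<Rightarrow> real \<Rightarrow> real" where
  "sqdist c z t = (cmod (z - c))\<^sup>2 + t\<^sup>2"

text \<open>
  The logarithm of \<open>sqdist c z t / t\<close> is the Busemann function of the boundary point \<open>c\<close>, and
  \<open>- ln t\<close> is the one of \<open>\<infinity>\<close>. With \<open>A\<close> the total weight, including the weight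
  \<open>A - sum a I\<close> of \<open>\<infinity>\<close>, the weighted sum of these functions takes this form.
\<close>

definition potential ::
  "'i set \<Rightarrow> ('i \<Rightarrow> real) \<Rightarrow> ('i \<Rightarrow> complex) \<Rightarrow> real \<Rightarrow> complex \<Rightarrow> real \<Rightarrow> real" where
  "potential I a c A z t = (\<Sum>k\<in>I. a k * ln (sqdist (c k) z t)) - A * ln t"

lemma sqdist_pos: "t > 0 \<Longrightarrow> sqdist c z t > 0"
  by (simp add: sqdist_def add_nonneg_pos)

lemma has_real_derivative_ln_sqdist_vertical:
  assumes "t > 0"
  shows "((\<lambda>s. ln (sqdist c z s)) has_real_derivative 2 * t / sqdist c z t) (at t)"
proof -
  have "((\<lambda>s. sqdist c z s) has_real_derivative 2 * t) (at t)"
    unfolding sqdist_def by (auto intro!: derivative_eq_intros)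
  from DERIV_chain'[OF this DERIV_ln[OF sqdist_pos[OF assms]]] show ?thesis
    by (simp add: divide_inverse mult.commute)
qed

lemma has_real_derivative_ln_sqdist_horizontal:
  assumes "t > 0"
  shows "((\<lambda>s. ln (sqdist c (z + s *\<^sub>R d) t)) has_real_derivative
           2 * ((z - c) \<bullet> d) / sqdist c z t) (at 0)"
proof -
  have "sqdist c (z + s *\<^sub>R d) t = sqdist c z t + s * (2 * ((z - c) \<bullet> d)) + s\<^sup>2 * (d \<bullet> d)" for s
    unfolding sqdist_def power2_norm_eq_inner
    by (simp add: inner_add_left inner_add_right inner_diff_left inner_diff_right inner_commute
        power2_eq_square algebra_simps)
  then have "((\<lambda>s. sqdist c (z + s *\<^sub>R d) t) has_real_derivative 2 * ((z - c) \<bullet> d)) (at 0)"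
    by (auto intro!: derivative_eq_intros)
  from DERIV_chain'[OF this, of ln "1 / sqdist c z t"] show ?thesis
    using DERIV_ln_divide[OF sqdist_pos[OF assms]] by (simp add: mult.commute)
qed

text \<open>
  As \<open>t\<close> tends to \<open>0\<close>, only the boundary points that coincide with the nearest one, \<open>w\<close>, can make
  the potential small: such a \<open>k\<close> contributes at least \<open>a k * ln (t\<^sup>2)\<close>, while the distance from
  any other \<open>c k\<close> to \<open>z\<close> is at least half of its distance to \<open>w\<close>. The bound depends on \<open>z\<close> only
  through \<open>w\<close>, and stability at \<open>w\<close> says that the coefficient of \<open>ln t\<close> is negative.
\<close>

lemma potential_lower_bound_near_boundary:
  assumes "finite I" and pos: "\<And>k. k \<in> I \<Longrightarrow> 0 < a k" and "t > 0"
    and near: "\<And>k. k \<in> I \<Longrightarrow> cmod (z - w) \<le> cmod (z - c k)"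
  shows "(2 * (\<Sum>k | k \<in> I \<and> c k = w. a k) - A) * ln t +
           (\<Sum>k | k \<in> I \<and> c k \<noteq> w. a k * ln ((cmod (w - c k) / 2)\<^sup>2))
         \<le> potential I a c A z t"
proof -
  have 1: "a k * (2 * ln t) \<le> a k * ln (sqdist (c k) z t)" if "k \<in> I" for k
  proof -
    have "ln (t\<^sup>2) \<le> ln (sqdist (c k) z t)"
      using \<open>t > 0\<close> sqdist_pos[of t "c k" z] by (subst ln_le_cancel_iff) (auto simp: sqdist_def)
    then show ?thesis using pos[OF that] \<open>t > 0\<close> by (simp add: ln_realpow)
  qed
  have 2: "a k * ln ((cmod (w - c k) / 2)\<^sup>2) \<le> a k * ln (sqdist (c k) z t)"
    if "k \<in> I" "c k \<noteq> w" for k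
  proof -
    have "cmod (w - c k) \<le> cmod (z - w) + cmod (z - c k)"
      using norm_triangle_ineq4[of "z - c k" "z - w"] by simp
    then have "cmod (w - c k) / 2 \<le> cmod (z - c k)" using near[OF that(1)] by simp
    then have "(cmod (w - c k) / 2)\<^sup>2 \<le> (cmod (z - c k))\<^sup>2"
      by (intro power_mono) auto
    then have "(cmod (w - c k) / 2)\<^sup>2 \<le> sqdist (c k) z t"
      unfolding sqdist_def using zero_le_power2[of t] by linarith
    moreover have "0 < (cmod (w - c k) / 2)\<^sup>2" using that by simp
    ultimately have "ln ((cmod (w - c k) / 2)\<^sup>2) \<le> ln (sqdist (c k) z t)"
      using sqdist_pos[OF \<open>t > 0\<close>] by (subst ln_le_cancel_iff) auto
    then show ?thesis using pos[OF that(1)] by simp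
  qed
  have split: "(\<Sum>k\<in>I. g k) = (\<Sum>k | k \<in> I \<and> c k = w. g k) + (\<Sum>k | k \<in> I \<and> c k \<noteq> w. g k)"
    for g :: "'a \<Rightarrow> real"
    using sum.union_disjoint[of "{k \<in> I. c k = w}" "{k \<in> I. c k \<noteq> w}" g] \<open>finite I\<close>
    by (subst sum.union_disjoint[symmetric]) (auto intro: sum.cong)
  have "(\<Sum>k | k \<in> I \<and> c k = w. a k * (2 * ln t)) +
          (\<Sum>k | k \<in> I \<and> c k \<noteq> w. a k * ln ((cmod (w - c k) / 2)\<^sup>2))
        \<le> (\<Sum>k\<in>I. a k * ln (sqdist (c k) z t))"
    unfolding split by (intro add_mono sum_mono) (use 1 2 in auto)
  then show ?thesis
    unfolding potential_def sum_distrib_right[symmetric] by (simp add: algebra_simps)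
qed

text \<open>
  Far from the origin all finite boundary points look alike: each is at distance at least half of
  the norm of \<open>(z, t)\<close>. Stability at \<open>\<infinity>\<close> says that the coefficient of the logarithm is positive.
\<close>

lemma potential_lower_bound_far_out:
  assumes "finite I" and pos: "\<And>k. k \<in> I \<Longrightarrow> 0 < a k" and "t > 0" and "A \<ge> 0"
    and far: "\<And>k. k \<in> I \<Longrightarrow> 2 * cmod (c k) \<le> norm (z, t)"
  shows "(2 * sum a I - A) * ln (norm (z, t)) - sum a I * ln 4 \<le> potential I a c A z t"
proof -
  define r where "r = norm (z, t)"
  have "t \<le> r" unfolding r_def using norm_snd_le[of t z] \<open>t > 0\<close> by simp
  then have "r > 0" using \<open>t > 0\<close> by simp
  have 1: "a k * (2 * ln r - ln 4) \<le> a k * ln (sqdist (c k) z t)" if "k \<in> I" for k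
  proof -
    have "norm (z, t) \<le> norm (c k, 0::real) + norm ((z, t) - (c k, 0))"
      by (rule norm_triangle_sub)
    then have "r \<le> cmod (c k) + norm (z - c k, t)" by (simp add: r_def norm_Pair)
    then have "r / 2 \<le> norm (z - c k, t)" using far[OF that] by (simp add: r_def)
    then have "(r / 2)\<^sup>2 \<le> (norm (z - c k, t))\<^sup>2"
      using \<open>r > 0\<close> by (intro power_mono) auto
    also have "\<dots> = sqdist (c k) z t" by (simp add: norm_Pair sqdist_def)
    finally have "ln ((r / 2)\<^sup>2) \<le> ln (sqdist (c k) z t)"
      using \<open>r > 0\<close> by (subst ln_le_cancel_iff) (auto intro: sqdist_pos[OF \<open>t > 0\<close>])
    also have "ln ((r / 2)\<^sup>2) = 2 * ln r - ln 4"
      using \<open>r > 0\<close> by (simp add: power_divide ln_div ln_realpow)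
    finally show ?thesis using pos[OF that] by simp
  qed
  have "sum a I * (2 * ln r - ln 4) \<le> (\<Sum>k\<in>I. a k * ln (sqdist (c k) z t))"
    unfolding sum_distrib_right by (intro sum_mono 1)
  moreover have "A * ln t \<le> A * ln r"
    using \<open>A \<ge> 0\<close> \<open>t \<le> r\<close> \<open>t > 0\<close> by (intro mult_left_mono) auto
  ultimately show ?thesis
    unfolding potential_def r_def[symmetric] by (simp add: algebra_simps)
qed

text \<open>
  Both hypotheses say that a boundary point has less than half of the total weight: \<open>far\<close> for the
  point \<open>\<infinity>\<close>, \<open>near\<close> for each finite point. They make the potential exceed its value at \<open>(0, 1)\<close>
  outside a compact part of the half-space, so that a minimum over this part is a global one.
\<close>

lemma stable_potential_attains_minimum:
  assumes fin: "finite I" and pos: "\<And>k. k \<in> I \<Longrightarrow> 0 < a k"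
    and far: "A < 2 * sum a I"
    and near: "\<And>w. 2 * (\<Sum>k | k \<in> I \<and> c k = w. a k) < A"
  obtains z t where "t > 0"
    "\<And>z' t'. t' > 0 \<Longrightarrow> potential I a c A z t \<le> potential I a c A z' t'"
proof -
  define F where "F = (\<lambda>p. potential I a c A (fst p) (snd p))"
  define M where "M = F (0, 1)"
  (* Stability at an arbitrary point, here 0, already forces a positive total weight. *)
  have "0 \<le> (\<Sum>k | k \<in> I \<and> c k = 0. a k)" using pos by (intro sum_nonneg) (auto intro: less_imp_le)
  then have "A > 0" using near[of 0] by simp
  have "I \<noteq> {}" using \<open>A > 0\<close> far by auto
  define low where "low w t = (2 * (\<Sum>k | k \<in> I \<and> c k = w. a k) - A) * ln t +
           (\<Sum>k | k \<in> I \<and> c k \<noteq> w. a k * ln ((cmod (w - c k) / 2)\<^sup>2))" for w t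
  have "\<forall>w\<in>c ` I. \<forall>\<^sub>F t in at_right 0. M < low w t"
  proof
    fix w
    have "filterlim (low w) at_top (at_right 0)"
      unfolding low_def
    proof (subst add.commute, rule filterlim_tendsto_add_at_top[OF tendsto_const])
      have "LIM t at_right 0. (A - 2 * (\<Sum>k | k \<in> I \<and> c k = w. a k)) * - ln t :> at_top"
        by (rule filterlim_tendsto_pos_mult_at_top[OF tendsto_const])
          (use near[of w] ln_at_0 in \<open>simp_all add: filterlim_uminus_at_top\<close>)
      then show "LIM t at_right 0. (2 * (\<Sum>k | k \<in> I \<and> c k = w. a k) - A) * ln t :> at_top"
        by (simp add: algebra_simps)
    qed
    then show "\<forall>\<^sub>F t in at_right 0. M < low w t" unfolding filterlim_at_top_dense by blast
  qed
  then have "\<forall>\<^sub>F t in at_right 0. \<forall>w\<in>c ` I. M < low w t"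
    by (intro eventually_ball_finite) (use fin in auto)
  then obtain \<epsilon> where "\<epsilon> > 0" and \<epsilon>: "\<And>t w. 0 < t \<Longrightarrow> t < \<epsilon> \<Longrightarrow> w \<in> c ` I \<Longrightarrow> M < low w t"
    unfolding eventually_at_right_field by blast
  have small: "M < F p" if "0 < snd p" "snd p < \<epsilon>" for p
  proof -
    obtain j where "j \<in> I" "\<And>k. k \<in> I \<Longrightarrow> cmod (fst p - c j) \<le> cmod (fst p - c k)"
      using ex_is_arg_min_if_finite[OF fin \<open>I \<noteq> {}\<close>, of "\<lambda>k. cmod (fst p - c k)"]
      by (auto simp: is_arg_min_linorder)
    then have "low (c j) (snd p) \<le> F p"
      unfolding low_def F_def
      by (intro potential_lower_bound_near_boundary fin pos that(1))
    then show ?thesis using \<epsilon>[OF that, of "c j"] \<open>j \<in> I\<close> by simp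
  qed
  have "filterlim (\<lambda>r. - (sum a I * ln 4) + (2 * sum a I - A) * ln r) at_top at_top"
    by (rule filterlim_tendsto_add_at_top[OF tendsto_const],
        rule filterlim_tendsto_pos_mult_at_top[OF tendsto_const _ ln_at_top]) (use far in simp)
  then have "\<forall>\<^sub>F r in at_top. M < (2 * sum a I - A) * ln r - sum a I * ln 4"
    unfolding filterlim_at_top_dense by (simp add: algebra_simps)
  then obtain R0 where R0: "\<And>r. r \<ge> R0 \<Longrightarrow> M < (2 * sum a I - A) * ln r - sum a I * ln 4"
    unfolding eventually_at_top_linorder by blast
  define R where "R = Max ({R0, 1} \<union> (\<lambda>k. 2 * cmod (c k)) ` I)"
  have R: "R0 \<le> R" "1 \<le> R" "\<And>k. k \<in> I \<Longrightarrow> 2 * cmod (c k) \<le> R"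
    unfolding R_def using fin by (auto intro!: Max_ge simp del: Max_insert)
  have large: "M < F p" if "0 < snd p" "R < norm p" for p
  proof -
    have "2 * cmod (c k) \<le> norm (fst p, snd p)" if "k \<in> I" for k
      using R(3)[OF that] \<open>R < norm p\<close> by simp
    then have "(2 * sum a I - A) * ln (norm (fst p, snd p)) - sum a I * ln 4 \<le> F p"
      unfolding F_def
      by (intro potential_lower_bound_far_out fin pos that(1) less_imp_le[OF \<open>A > 0\<close>])
    then show ?thesis using R0[of "norm p"] R(1) that(2) by simp
  qed
  define K where "K = cball 0 R \<inter> {p :: complex \<times> real. min \<epsilon> 1 \<le> snd p}"
  have "compact K" unfolding K_def
    by (intro compact_Int_closed compact_cball closed_Collect_le continuous_intros)
  moreover have "(0, 1) \<in> K" using R(2) by (simp add: K_def norm_Pair)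
  moreover have "continuous_on K F"
  proof -
    have "snd p > 0" if "p \<in> K" for p using that \<open>\<epsilon> > 0\<close> by (auto simp: K_def)
    then show ?thesis
      unfolding F_def potential_def sqdist_def
      by (intro continuous_intros) (force simp: add_nonneg_pos)+
  qed
  ultimately obtain p where p: "p \<in> K" "\<And>q. q \<in> K \<Longrightarrow> F p \<le> F q"
    using continuous_attains_inf[of K F] by blast
  have "F p \<le> M" unfolding M_def using p(2) \<open>(0, 1) \<in> K\<close> by blast
  have "F p \<le> F q" if "snd q > 0" for q
  proof (cases "q \<in> K")
    case False
    then have "snd q < \<epsilon> \<or> R < norm q" by (auto simp: K_def)
    then show ?thesis using small large that \<open>F p \<le> M\<close> by fastforce
  qed (rule p(2))
  moreover have "snd p > 0" using p(1) \<open>\<epsilon> > 0\<close> by (auto simp: K_def)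
  ultimately show ?thesis using that[of "snd p" "fst p"] unfolding F_def by force
qed

text \<open>
  The two equations are the vanishing of the horizontal and the vertical derivative of the
  potential at its minimum.
\<close>

lemma ex_balanced_point:
  assumes fin: "finite I" and pos: "\<And>k. k \<in> I \<Longrightarrow> 0 < a k"
    and far: "A < 2 * sum a I"
    and near: "\<And>w. 2 * (\<Sum>k | k \<in> I \<and> c k = w. a k) < A"
  obtains z t where "t > 0"
    "(\<Sum>k\<in>I. complex_of_real (a k / sqdist (c k) z t) * (z - c k)) = 0"
    "(\<Sum>k\<in>I. a k * t\<^sup>2 / sqdist (c k) z t) = A / 2"
proof -
  obtain z t where t: "t > 0"
    and min: "\<And>z' t'. t' > 0 \<Longrightarrow> potential I a c A z t \<le> potential I a c A z' t'"
    by (rule stable_potential_attains_minimum[of I a A c, OF fin pos far near])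
      (assumption, (rule that; assumption))
  have "((\<lambda>s. potential I a c A z s) has_real_derivative
          (\<Sum>k\<in>I. a k * (2 * t / sqdist (c k) z t)) - A / t) (at t)"
    unfolding potential_def
    by (intro DERIV_diff DERIV_sum DERIV_cmult has_real_derivative_ln_sqdist_vertical t)
      (use DERIV_cmult[OF DERIV_ln_divide[OF t], of A] in simp)
  then have "(\<Sum>k\<in>I. a k * (2 * t / sqdist (c k) z t)) - A / t = 0"
    by (rule DERIV_local_min[OF _ t]) (use min in auto)
  then have vertical: "(\<Sum>k\<in>I. a k * t\<^sup>2 / sqdist (c k) z t) = A / 2"
    using t by (simp add: field_simps power2_eq_square sum_distrib_left sum_distrib_right)
  have horizontal: "(\<Sum>k\<in>I. a k * ((z - c k) \<bullet> d) / sqdist (c k) z t) = 0" for d :: complex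
  proof -
    have "((\<lambda>s. potential I a c A (z + s *\<^sub>R d) t) has_real_derivative
          (\<Sum>k\<in>I. a k * (2 * ((z - c k) \<bullet> d) / sqdist (c k) z t))) (at 0)"
      unfolding potential_def
      using DERIV_diff[OF DERIV_sum[OF DERIV_cmult[OF has_real_derivative_ln_sqdist_horizontal[OF t]]]
          DERIV_const] by simp
    then have "(\<Sum>k\<in>I. a k * (2 * ((z - c k) \<bullet> d) / sqdist (c k) z t)) = 0"
      by (rule DERIV_local_min[OF _ zero_less_one]) (use min t in auto)
    also have "(\<Sum>k\<in>I. a k * (2 * ((z - c k) \<bullet> d) / sqdist (c k) z t))
        = 2 * (\<Sum>k\<in>I. a k * ((z - c k) \<bullet> d) / sqdist (c k) z t)"
      by (simp add: sum_distrib_left mult_ac)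
    finally show ?thesis by simp
  qed
  (* The directions 1 and \<i> give the real and the imaginary part. *)
  have "(\<Sum>k\<in>I. complex_of_real (a k / sqdist (c k) z t) * (z - c k)) = 0"
    using horizontal[of 1] horizontal[of \<i>]
    by (intro complex_eqI)
      (simp_all add: inner_complex_def)
  then show ?thesis using that t vertical by blast
qed

section \<open>Projections onto lines and necessary conditions\<close>

lemma hermitian_scalar_productD:
  assumes "hermitian_scalar_product B"
  shows "B (x + y) z = B x z + B y z" "B (k *s x) y = k * B x y" "B y x = cnj (B x y)"
    "x \<noteq> 0 \<Longrightarrow> 0 < Re (B x x)" "B 0 y = 0" "B x 0 = 0"
    "B z (x + y) = B z x + B z y" "B y (k *s x) = cnj k * B y x"
    "B (x - y) z = B x z - B y z"
proof -
  note B = assms[unfolded hermitian_scalar_product_def]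
  show 1: "B (x + y) z = B x z + B y z" for x y z using B by blast
  show 2: "B (k *s x) y = k * B x y" for k x y using B by blast
  show 3: "B y x = cnj (B x y)" for x y using B by blast
  show "x \<noteq> 0 \<Longrightarrow> 0 < Re (B x x)" using B by blast
  show 4: "B 0 y = 0" for y using 2[of 0 0 y] by simp
  show "B x 0 = 0" by (subst 3) (simp add: 4)
  show "B z (x + y) = B z x + B z y" by (subst (1 2 3) 3) (simp add: 1)
  show "B y (k *s x) = cnj k * B y x" by (subst (1 2) 3) (simp add: 2)
  show "B (x - y) z = B x z - B y z" using 1[of "x - y" y z] by simp
qed

lemma orthogonal_projection_span_singleton:
  assumes B: "hermitian_scalar_product B" and "v \<noteq> 0"
  shows "orthogonal_projection B (vec.span {v}) (\<lambda>x. (B x v / B v v) *s v)"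
proof -
  have "B v v \<noteq> 0" using hermitian_scalar_productD(4)[OF B \<open>v \<noteq> 0\<close>] by auto
  then show ?thesis
    unfolding orthogonal_projection_def
    using vec.subspace_span[of "{v}"] by (auto simp: vec.span_singleton hermitian_scalar_productD(1,2,5-9)[OF B])
qed

lemma orthogonal_projection_span_singleton_unique:
  assumes B: "hermitian_scalar_product B" and "v \<noteq> 0"
    and P: "orthogonal_projection B (vec.span {v}) P"
  shows "P x = (B x v / B v v) *s v"
proof -
  have "B v v \<noteq> 0" using hermitian_scalar_productD(4)[OF B \<open>v \<noteq> 0\<close>] by auto
  obtain k where k: "P x = k *s v"
    using P unfolding orthogonal_projection_def vec.span_singleton by blast
  have "B (x - P x) v = 0"
    using P vec.span_base[of v "{v}"] unfolding orthogonal_projection_def by blast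
  then show ?thesis using \<open>B v v \<noteq> 0\<close> by (simp add: k hermitian_scalar_productD(1,2,5-9)[OF B])
qed

text \<open>
  The projection onto the line of \<open>v\<close> is \<open>x \<mapsto> \<phi> x *s v\<close> for a linear form \<open>\<phi>\<close> with
  \<open>\<phi> v = 1\<close>, so its trace is \<open>1\<close> for every scalar product. The trace is computed from the
  standard coordinates, which avoids a basis adapted to the scalar product.
\<close>

lemma unitarizable_lines_trace:
  fixes v :: "nat \<Rightarrow> complex^2"
  assumes "unitarizable S a"
    and S: "\<And>k. k \<in> {1..4} \<Longrightarrow> S k = vec.span {v k} \<and> v k \<noteq> 0"
  shows "2 * a 0 = (\<Sum>k=1..4. a k)"
proof -
  obtain B P where B: "hermitian_scalar_product B"
    and P: "\<And>k. k \<in> {1..4} \<Longrightarrow> orthogonal_projection B (S k) (P k)"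
    and sum: "\<And>x. (\<Sum>k=1..4. complex_of_real (a k) *s P k x) = complex_of_real (a 0) *s x"
    using assms(1) unfolding unitarizable_def by blast
  have tr: "(\<Sum>i\<in>UNIV. P k (axis i 1) $ i) = 1" if "k \<in> {1..4}" for k
  proof -
    have "B (v k) (v k) \<noteq> 0" using hermitian_scalar_productD(4)[OF B, of "v k"] S[OF that] by auto
    have "(\<Sum>i\<in>UNIV. P k (axis i 1) $ i) = (\<Sum>i\<in>UNIV. B (axis i 1) (v k) * v k $ i) / B (v k) (v k)"
      using orthogonal_projection_span_singleton_unique[OF B, of "v k" "P k"] P[OF that] S[OF that]
      by (simp add: sum_divide_distrib)
    also have "(\<Sum>i\<in>UNIV. B (axis i 1) (v k) * v k $ i) = B (\<Sum>i\<in>UNIV. v k $ i *s axis i 1) (v k)"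
      by (simp add: sum_2 hermitian_scalar_productD(1,2)[OF B] mult.commute)
    also have "(\<Sum>i\<in>UNIV. v k $ i *s axis i 1) = v k" by (rule basis_expansion)
    finally show ?thesis using \<open>B (v k) (v k) \<noteq> 0\<close> by simp
  qed
  have "complex_of_real (2 * a 0) = (\<Sum>i\<in>(UNIV::2 set). (complex_of_real (a 0) *s axis i 1) $ i)"
    by (simp add: sum_2)
  also have "\<dots> = (\<Sum>i\<in>(UNIV::2 set). \<Sum>k=1..4. complex_of_real (a k) * P k (axis i 1) $ i)"
    by (simp add: sum[symmetric] sum_component)
  also have "\<dots> = (\<Sum>k=1..4. complex_of_real (a k) * (\<Sum>i\<in>UNIV. P k (axis i 1) $ i))"
    by (subst sum.swap) (simp add: sum_distrib_left)
  also have "\<dots> = complex_of_real (\<Sum>k=1..4. a k)" using tr by simp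
  finally show ?thesis unfolding of_real_eq_iff .
qed

text \<open>
  Pairing \<open>\<Sum> a\<^sub>k P\<^sub>k v = a\<^sub>0 v\<close> with \<open>v\<close> gives \<open>a\<^sub>0 |v|\<^sup>2 = \<Sum> a\<^sub>k |P\<^sub>k v|\<^sup>2\<close>, and the term
  \<open>k = i\<close> is \<open>a\<^sub>i |v|\<^sup>2\<close>. The inequality is strict because \<open>v\<close>, being a sum of vectors of
  other subspaces, cannot be orthogonal to all of these.
\<close>

lemma unitarizable_weight_less:
  assumes "unitarizable S a" and pos: "\<And>k. k \<in> {1..4} \<Longrightarrow> 0 < a k"
    and i: "i \<in> {1..4}" "v \<in> S i" "v \<noteq> 0"
    and "j \<in> {1..4} - {i}" "k \<in> {1..4} - {i}" "v = x + y" "x \<in> S j" "y \<in> S k"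
  shows "a i < a 0"
proof -
  obtain B P where B: "hermitian_scalar_product B"
    and P: "\<And>k. k \<in> {1..4} \<Longrightarrow> orthogonal_projection B (S k) (P k)"
    and sum: "\<And>x. (\<Sum>k=1..4. complex_of_real (a k) *s P k x) = complex_of_real (a 0) *s x"
    using assms(1) unfolding unitarizable_def by blast
  note [simp] = hermitian_scalar_productD(1,2,5,6,7,8,9)[OF B]
  have Bv: "Re (B v v) > 0" using hermitian_scalar_productD(4)[OF B \<open>v \<noteq> 0\<close>] .
  have nonneg: "0 \<le> Re (B u u)" for u
    using hermitian_scalar_productD(4)[OF B, of u] by (cases "u = 0") auto
  have orth: "B v w = B (P k v) w" if "k \<in> {1..4}" "w \<in> S k" for k w
    using P[OF that(1)] that(2) unfolding orthogonal_projection_def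
    by (metis eq_iff_diff_eq_0 hermitian_scalar_productD(9)[OF B])
  have in_S: "P k v \<in> S k" if "k \<in> {1..4}" for k
    using P[OF that] unfolding orthogonal_projection_def by blast
  have quad: "Re (B (P k v) v) = Re (B (P k v) (P k v))" if "k \<in> {1..4}" for k
    using orth[OF that in_S[OF that]] hermitian_scalar_productD(3)[OF B, of "P k v" v] by simp
  have "P i v = v"
  proof -
    have "P i v - v \<in> S i"
      using P[OF i(1)] i(2) in_S[OF i(1)] unfolding orthogonal_projection_def
      by (auto intro: vec.subspace_diff)
    then have "B (P i v - v) (P i v - v) = 0" using orth[OF i(1)] by simp
    then show ?thesis using hermitian_scalar_productD(4)[OF B, of "P i v - v"] by auto
  qed
  have "\<exists>l\<in>{1..4} - {i}. 0 < Re (B (P l v) v)"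
  proof (rule ccontr)
    assume *: "\<not> ?thesis"
    have "P l v = 0" if "l \<in> {1..4} - {i}" for l
      using * quad[of l] that hermitian_scalar_productD(4)[OF B, of "P l v"] by force
    then have "B v x = 0" "B v y = 0"
      using orth[of j x] orth[of k y] assms(6-) by auto
    then have "B v v = 0" using \<open>v = x + y\<close> by (metis hermitian_scalar_productD(7)[OF B] add_0)
    then show False using Bv by simp
  qed
  then obtain l where l: "l \<in> {1..4} - {i}" "0 < Re (B (P l v) v)" by blast
  have B_sum: "B (\<Sum>k\<in>K. f k) v = (\<Sum>k\<in>K. B (f k) v)" if "finite K" for f and K :: "nat set"
    using that by induction auto
  have "a i * Re (B v v) + 0 < a i * Re (B (P i v) v) + (\<Sum>k\<in>{1..4} - {i}. a k * Re (B (P k v) v))"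
    unfolding \<open>P i v = v\<close>
    by (intro add_strict_left_mono sum_pos2[OF _ l(1)]) (use l pos quad nonneg in \<open>auto intro!: mult_nonneg_nonneg less_imp_le[OF pos]\<close>)
  also have "\<dots> = (\<Sum>k=1..4. a k * Re (B (P k v) v))"
    using i(1) by (subst sum.remove[of "{1..4}" i]) auto
  also have "\<dots> = Re (B (\<Sum>k=1..4. complex_of_real (a k) *s P k v) v)"
    by (simp add: B_sum)
  also have "\<dots> = a 0 * Re (B v v)" unfolding sum by simp
  finally show ?thesis using Bv by simp
qed

section \<open>Unitarization from a balanced point\<close>

lemma basis2_coordinates:
  assumes "basis2 e1 e2"
  obtains p q where "\<And>x. x = p x *s e1 + q x *s e2"
    "\<And>x y. p (x + y) = p x + p y" "\<And>k x. p (k *s x) = k * p x"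
    "\<And>x y. q (x + y) = q x + q y" "\<And>k x. q (k *s x) = k * q x"
    "p e1 = 1" "q e1 = 0" "p e2 = 0" "q e2 = 1"
proof -
  note b = assms[unfolded basis2_def]
  define p where "p x = vec.representation {e1, e2} x e1" for x
  define q where "q x = vec.representation {e1, e2} x e2" for x
  have "x = p x *s e1 + q x *s e2" for x
    using vec.sum_representation_eq[of "{e1, e2}" x "{e1, e2}"] b by (simp add: p_def q_def)
  moreover have "p (x + y) = p x + p y" "q (x + y) = q x + q y"
    "p (k *s x) = k * p x" "q (k *s x) = k * q x" for x y k
    using vec.representation_add[of "{e1, e2}" y x] vec.representation_scale[of "{e1, e2}" x k] b
    by (simp_all add: p_def q_def fun_eq_iff)
  moreover have "p e1 = 1" "q e1 = 0" "p e2 = 0" "q e2 = 1"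
    using vec.representation_basis[of "{e1, e2}"] b by (auto simp: p_def q_def)
  ultimately show ?thesis using that by blast
qed

text \<open>
  The scalar product is the one with parameter \<open>(z, t)\<close> a balanced point. In the orthonormal
  coordinates \<open>u\<close> and \<open>t * q\<close>, the projection onto the line of \<open>e2 - c k *s e1\<close> has, up to the
  factor \<open>1 / sqdist (c k) z t\<close>, the diagonal entries \<open>|z - c k|\<^sup>2\<close> and \<open>t\<^sup>2\<close> and the
  off-diagonal entries \<open>t * (z - c k)\<close> and its conjugate. The two balance equations say that the
  weighted sum has off-diagonal entries \<open>0\<close> and second diagonal entry \<open>a 0\<close>; the first diagonal
  entry is then \<open>a 0\<close> as well, by the trace condition.
\<close>

lemma unitarizable_of_stable_slopes:
  assumes "basis2 e1 e2"
    and S1: "S 1 = vec.span {e1}"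
    and S: "\<And>k. k \<in> {2..4} \<Longrightarrow> S k = vec.span {e2 - c k *s e1}"
    and pos: "\<And>k. k \<in> {1..4} \<Longrightarrow> 0 < a k"
    and a0: "2 * a 0 = (\<Sum>k=1..4. a k)"
    and far: "2 * a 1 < (\<Sum>k=1..4. a k)"
    and near: "\<And>w. 2 * (\<Sum>k | k \<in> {2..4} \<and> c k = w. a k) < (\<Sum>k=1..4. a k)"
  shows "unitarizable S a"
proof -
  define I where "I = {2..4::nat}"
  have split: "(\<Sum>k=1..4. f k) = f 1 + (\<Sum>k\<in>I. f k)" for f :: "nat \<Rightarrow> 'x::comm_monoid_add"
  proof -
    have "{1..4} = insert 1 I" by (auto simp: I_def)
    then show ?thesis by (simp add: I_def)
  qed
  have "sum a {1..4} < 2 * sum a I" using far unfolding split by simp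
  then obtain z t where t: "t > 0"
    and bal: "(\<Sum>k\<in>I. complex_of_real (a k / sqdist (c k) z t) * (z - c k)) = 0"
    and vert: "(\<Sum>k\<in>I. a k * t\<^sup>2 / sqdist (c k) z t) = a 0"
  proof -
    have half: "(\<Sum>k=1..4. a k) / 2 = a 0" using a0 by simp
    have "finite I" and posI: "k \<in> I \<Longrightarrow> 0 < a k" for k using pos by (auto simp: I_def)
    show ?thesis
      by (rule ex_balanced_point[of I a "sum a {1..4}" c,
            OF \<open>finite I\<close> posI \<open>sum a {1..4} < 2 * sum a I\<close> near[folded I_def]])
        (assumption, rule that, simp_all only: half)
  qed
  define D where "D k = sqdist (c k) z t" for k
  have D: "D k > 0" for k unfolding D_def by (rule sqdist_pos[OF t])
  obtain p q where pq: "\<And>x. x = p x *s e1 + q x *s e2"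
    and lin [simp]: "\<And>x y. p (x + y) = p x + p y" "\<And>k x. p (k *s x) = k * p x"
    "\<And>x y. q (x + y) = q x + q y" "\<And>k x. q (k *s x) = k * q x"
    "p e1 = 1" "q e1 = 0" "p e2 = 0" "q e2 = 1"
    by (rule basis2_coordinates[OF assms(1)]) (rule that; assumption)
  define u where "u x = p x + z * q x" for x
  define B where "B x y = u x * cnj (u y) + t\<^sup>2 * (q x * cnj (q y))" for x y
  have Bxx: "B x x = complex_of_real ((cmod (u x))\<^sup>2 + t\<^sup>2 * (cmod (q x))\<^sup>2)" for x
    unfolding B_def by (simp add: complex_norm_square[symmetric])
  have B: "hermitian_scalar_product B"
    unfolding hermitian_scalar_product_def
  proof (intro conjI allI impI)
    fix x :: "complex^2" assume "x \<noteq> 0"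
    then have "u x \<noteq> 0 \<or> q x \<noteq> 0" using pq[of x] by (auto simp: u_def)
    then show "0 < Re (B x x)" using t unfolding Bxx by (auto simp: add_pos_nonneg add_nonneg_pos)
  qed (auto simp: B_def u_def algebra_simps)
  define v where "v k = (if k = 1 then e1 else e2 - c k *s e1)" for k
  have [simp]: "p (x - y) = p x - p y" "q (x - y) = q x - q y" for x y
    using lin(1)[of "x - y" y] lin(3)[of "x - y" y] by (simp_all del: lin)
  have "p 0 = 0" "q 0 = 0" using lin(2)[of 0 0] lin(4)[of 0 0] by simp_all
  have v0: "v k \<noteq> 0" for k
  proof
    assume "v k = 0"
    then have "p (v k) = 0" "q (v k) = 0" using \<open>p 0 = 0\<close> \<open>q 0 = 0\<close> by simp_all
    then show False by (auto simp: v_def split: if_splits)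
  qed
  define P where "P k x = (B x (v k) / B (v k) (v k)) *s v k" for k x
  have Sv: "S k = vec.span {v k}" if "k \<in> {1..4}" for k
    using that S1 S[of k] by (cases "k = 1") (auto simp: v_def)
  have P1: "P 1 x = u x *s e1" for x by (simp add: P_def v_def B_def u_def)
  have Pk: "P k x = ((u x * cnj (z - c k) + t\<^sup>2 * q x) / D k) *s (e2 - c k *s e1)" if "k \<in> I" for k x
  proof -
    have "k \<noteq> 1" using that by (auto simp: I_def)
    have "B (v k) (v k) = D k"
      unfolding Bxx using \<open>k \<noteq> 1\<close> by (simp add: v_def u_def D_def sqdist_def)
    then show ?thesis using \<open>k \<noteq> 1\<close> by (simp add: P_def v_def B_def u_def)
  qed
  have "(\<Sum>k=1..4. complex_of_real (a k) *s P k x) = complex_of_real (a 0) *s x" for x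
  proof -
    have bal': "(\<Sum>k\<in>I. a k * (z - c k) / D k) = 0" using bal by (simp add: D_def mult_ac)
    have "(\<Sum>k\<in>I. a k * cnj (z - c k) / D k) = cnj (\<Sum>k\<in>I. a k * (z - c k) / D k)"
      by (simp add: cnj_sum)
    then have bal'': "(\<Sum>k\<in>I. a k * cnj (z - c k) / D k) = 0"
      unfolding bal' by simp
    have vert': "(\<Sum>k\<in>I. complex_of_real (a k) * t\<^sup>2 / D k) = complex_of_real (a 0)"
      using arg_cong[OF vert, of complex_of_real] by (simp add: D_def)
    define s where "s k = a k * (u x * cnj (z - c k) + t\<^sup>2 * q x) / D k" for k
    (* s k is the coefficient of the vector a k P k x along e2 - c k e1. *)
    have e2: "(\<Sum>k\<in>I. s k) = a 0 * q x"
    proof -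
      have "(\<Sum>k\<in>I. s k) = u x * (\<Sum>k\<in>I. a k * cnj (z - c k) / D k) 
          + (\<Sum>k\<in>I. complex_of_real (a k) * t\<^sup>2 / D k) * q x"
        unfolding sum_distrib_left sum_distrib_right sum.distrib[symmetric] s_def
        by (intro sum.cong) (simp_all add: algebra_simps add_divide_distrib diff_divide_distrib)
      then show ?thesis unfolding bal'' vert' by simp
    qed
    (* The e1-coordinate of the sum involves - c k; writing it as (z - c k) - z brings in the balance
       equations, and the term |z - c k|^2 = D k - t^2 supplies the trace. *)
    have "s k * (z - c k) = u x * a k - u x * (complex_of_real (a k) * t\<^sup>2 / D k)
        + t\<^sup>2 * q x * (a k * (z - c k) / D k)" for k
    proof -
      have sq: "cnj (z - c k) * (z - c k) = complex_of_real (D k) - t\<^sup>2"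
        using complex_norm_square[of "z - c k"]
        by (simp add: D_def sqdist_def mult.commute del: complex_cnj_diff)
      have "s k * (z - c k) = a k * (u x * (cnj (z - c k) * (z - c k)) + t\<^sup>2 * q x * (z - c k)) / D k"
        by (simp add: s_def algebra_simps)
      then show ?thesis
        unfolding sq using D[of k] by (simp only:) (simp add: divide_simps, simp add: algebra_simps)
    qed
    then have "(\<Sum>k\<in>I. s k * (z - c k)) = u x * (\<Sum>k\<in>I. complex_of_real (a k))
        - u x * (\<Sum>k\<in>I. complex_of_real (a k) * t\<^sup>2 / D k)
        + t\<^sup>2 * q x * (\<Sum>k\<in>I. a k * (z - c k) / D k)"
      by (simp only: sum.distrib sum_subtractf sum_distrib_left)
    also have "\<dots> = u x * ((\<Sum>k\<in>I. complex_of_real (a k)) - a 0)"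
      unfolding bal' vert' by (simp add: algebra_simps)
    also have "(\<Sum>k\<in>I. complex_of_real (a k)) = 2 * a 0 - a 1"
      using a0 unfolding split by (simp flip: of_real_sum)
    finally have e1: "(\<Sum>k\<in>I. s k * (z - c k)) = u x * (a 0 - a 1)" by (simp add: algebra_simps)
    have "(\<Sum>k\<in>I. s k * c k) = z * (\<Sum>k\<in>I. s k) - (\<Sum>k\<in>I. s k * (z - c k))"
      by (simp add: sum_distrib_left algebra_simps sum_subtractf)
    then have e1': "a 1 * u x - (\<Sum>k\<in>I. s k * c k) = a 0 * p x"
      unfolding e1 e2 by (simp add: u_def algebra_simps)
    have "(\<Sum>k=1..4. complex_of_real (a k) *s P k x)
        = complex_of_real (a 1) *s P 1 x + (\<Sum>k\<in>I. complex_of_real (a k) *s P k x)" by (rule split)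
    also have "(\<Sum>k\<in>I. complex_of_real (a k) *s P k x) = (\<Sum>k\<in>I. s k *s e2 - (s k * c k) *s e1)"
      by (intro sum.cong) (simp_all add: Pk s_def vec.scale_right_diff_distrib mult_ac)
    also have "\<dots> = (\<Sum>k\<in>I. s k) *s e2 - (\<Sum>k\<in>I. s k * c k) *s e1"
      by (simp add: sum_subtractf vec.scale_sum_left)
    also have "complex_of_real (a 1) *s P 1 x + \<dots> = (a 1 * u x - (\<Sum>k\<in>I. s k * c k)) *s e1 + (\<Sum>k\<in>I. s k) *s e2"
      unfolding P1 by (simp add: vec.scale_left_diff_distrib)
    also have "\<dots> = complex_of_real (a 0) *s (p x *s e1 + q x *s e2)"
      unfolding e1' e2 by (simp add: vec.scale_right_distrib)
    finally show ?thesis using pq[of x] by simp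
  qed
  moreover have "orthogonal_projection B (S k) (P k)" if "k \<in> {1..4}" for k
    unfolding Sv[OF that] P_def by (rule orthogonal_projection_span_singleton[OF B v0])
  ultimately show ?thesis unfolding unitarizable_def using B by blast
qed

lemma span_singleton_scale:
  fixes v :: "complex^'n"
  assumes "k \<noteq> 0"
  shows "vec.span {k *s v} = vec.span {v}"
proof -
  have "vec.span {k *s v} \<subseteq> vec.span {v}" for k and v :: "complex^'n"
    by (simp add: vec.span_minimal vec.span_base vec.span_scale)
  from this[of k v] this[of "inverse k" "k *s v"] show ?thesis using assms by auto
qed

theorem theorem4:
  fixes e1 e2 :: "complex^2" and a :: "nat \<Rightarrow> real"
  assumes "basis2 e1 e2" and "character a"
  shows "(a 1 + a 2 > a 3 + a 4 \<and> a 1 < a 2 + a 3 + a 4 \<and> a 2 < a 1 + a 3 + a 4 \<and>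
            2 * a 0 = a 1 + a 2 + a 3 + a 4 \<and> (\<forall>i\<in>{1..4}. a i > 0)
          \<longrightarrow> unitarizable (S_34 e1 e2) a) \<and>
         (\<forall>\<mu>::complex. \<mu> \<noteq> 0 \<and> \<mu> \<noteq> 1 \<longrightarrow>
            (unitarizable (S_nondegenerate e1 e2 \<mu>) a \<longleftrightarrow>
               (\<forall>i\<in>{1..4}. 2 * a i < (\<Sum>j=1..4. a j)) \<and>
               2 * a 0 = (\<Sum>j=1..4. a j) \<and>
               (\<forall>i\<in>{1..4}. 0 < a i \<and> a i < a 0)))"
proof -
  have sum4: "(\<Sum>k=1..4. a k) = a 1 + a 2 + a 3 + a 4" by (simp add: eval_nat_numeral)
  have pos: "0 < a k" if "k \<in> {1..4}" for k using assms(2) that by (auto simp: character_def)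
  have all4: "(\<forall>i\<in>{1..4::nat}. Q i) \<longleftrightarrow> Q 1 \<and> Q 2 \<and> Q 3 \<and> Q 4" for Q
    by (auto simp: eval_nat_numeral le_Suc_eq Ball_def)
  have set3: "{2..4::nat} = {2, 3, 4}" by auto
  have Collect3: "{k. k \<in> {2, 3, 4} \<and> c k = w} =
      (if c 2 = w then {2} else {}) \<union> (if c 3 = w then {3} else {}) \<union> (if c 4 = w then {4} else {})"
    for c :: "nat \<Rightarrow> complex" and w by auto
  have p: "0 < a 1" "0 < a 2" "0 < a 3" "0 < a 4" using pos by auto
  (* Here c 3 = c 4 = - 1, so this boundary point has weight a 3 + a 4. *)
  have degenerate: "unitarizable (S_34 e1 e2) a"
    if "a 1 + a 2 > a 3 + a 4" "a 1 < a 2 + a 3 + a 4" "a 2 < a 1 + a 3 + a 4"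
      "2 * a 0 = a 1 + a 2 + a 3 + a 4"
  proof (rule unitarizable_of_stable_slopes[OF assms(1), where c = "\<lambda>k. if k = 2 then 0 else - 1"])
    show "2 * (\<Sum>k | k \<in> {2..4} \<and> (if k = 2 then 0 else - 1) = w. a k) < (\<Sum>k=1..4. a k)" for w :: complex
      unfolding set3 Collect3 sum4 using that p by auto
    show "2 * a 0 = (\<Sum>k=1..4. a k)" "2 * a 1 < (\<Sum>k=1..4. a k)"
      unfolding sum4 using that by simp_all
  qed (use pos in \<open>auto simp: S_34_def set3 add.commute\<close>)
  have nondegenerate: "unitarizable (S_nondegenerate e1 e2 \<mu>) a \<longleftrightarrow>
               (\<forall>i\<in>{1..4}. 2 * a i < (\<Sum>j=1..4. a j)) \<and>
               2 * a 0 = (\<Sum>j=1..4. a j) \<and>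
               (\<forall>i\<in>{1..4}. 0 < a i \<and> a i < a 0)" (is "?U \<longleftrightarrow> ?C")
    if \<mu>: "\<mu> \<noteq> 0" "\<mu> \<noteq> 1" for \<mu>
  proof
    assume C: ?C
    define c where "c k = (if k = 2 then 0 else if k = 3 then - inverse \<mu> else - 1)" for k :: nat
    have c: "c 2 = 0" "c 3 = - inverse \<mu>" "c 4 = - 1" by (simp_all add: c_def)
    have ne: "inverse \<mu> \<noteq> 0" "inverse \<mu> \<noteq> 1" "1 \<noteq> inverse \<mu>"
      using \<mu> by (auto simp: field_simps)
    show ?U
    proof (rule unitarizable_of_stable_slopes[OF assms(1), where c = c])
      show "2 * (\<Sum>k | k \<in> {2..4} \<and> c k = w. a k) < (\<Sum>k=1..4. a k)" for w
        unfolding set3 Collect3 c using C ne p unfolding all4 sum4 by auto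
      (* The third line, of slope \<mu>, is the boundary point - 1 / \<mu>; it differs from 0 and from - 1
         as \<mu> is finite and different from 1, so the four lines are distinct. *)
      have "e1 + \<mu> *s e2 = \<mu> *s (e2 - c 3 *s e1)"
        using \<mu> by (simp add: c vec.scale_right_distrib add.commute)
      then show "S_nondegenerate e1 e2 \<mu> k = vec.span {e2 - c k *s e1}" if "k \<in> {2..4}" for k
        using that span_singleton_scale[OF \<mu>(1), of "e2 - c 3 *s e1"]
        unfolding set3 by (auto simp: S_nondegenerate_def c add.commute)
    qed (use C pos in \<open>auto simp: S_nondegenerate_def\<close>)
  next
    assume U: ?U
    obtain p q where "\<And>x. x = p x *s e1 + q x *s e2" "\<And>x y. p (x + y) = p x + p y" "\<And>k x. p (k *s x) = k * (p x :: complex)"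
      "\<And>x y. q (x + y) = q x + q y" "\<And>k x. q (k *s x) = k * (q x :: complex)"
      "p e1 = 1" "q e1 = 0" "p e2 = 0" "q e2 = 1"
      by (rule basis2_coordinates[OF assms(1)]) (rule that; assumption)
    then have "p (e1 + k *s e2) = 1" "p 0 = 0" "q 0 = 0" for k
      using \<open>\<And>k x. p (k *s x) = k * (p x :: complex)\<close>[of 0 0] \<open>\<And>k x. q (k *s x) = k * (q x :: complex)\<close>[of 0 0] by simp_all
    then have ne: "e1 \<noteq> 0" "e2 \<noteq> 0" "e1 + k *s e2 \<noteq> 0" for k
      using \<open>p e1 = 1\<close> \<open>q e2 = 1\<close> by (metis zero_neq_one)+
    have ne4: "e1 + e2 \<noteq> 0" using ne(3)[of 1] by simp
    let ?S = "S_nondegenerate e1 e2 \<mu>"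
    define v where "v = (\<lambda>_::nat. e1)(2 := e2, 3 := e1 + \<mu> *s e2, 4 := e1 + e2)"
    have "\<forall>k\<in>{1..4}. ?S k = vec.span {v k} \<and> v k \<noteq> 0"
      unfolding all4 using ne ne4 by (simp add: v_def S_nondegenerate_def)
    then have tr: "2 * a 0 = (\<Sum>j=1..4. a j)" using unitarizable_lines_trace[OF U, of v] by blast
    have mem: "k *s e1 \<in> ?S 1" "k *s e2 \<in> ?S 2" "e1 + \<mu> *s e2 \<in> ?S 3" "e1 + e2 \<in> ?S 4" for k
      by (auto simp: S_nondegenerate_def vec.span_base vec.span_scale)
    note mem' = mem(1,2)[of 1] mem(1,2)[of "- 1"] mem
    (* On each line a vector is written as a sum of vectors of two other lines. *)
    have "a 1 < a 0"
      by (rule unitarizable_weight_less[OF U pos, of 1 e1 4 2 "e1 + e2" "- 1 *s e2"])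
        (use mem' ne in auto)
    moreover have "a 2 < a 0"
      by (rule unitarizable_weight_less[OF U pos, of 2 e2 4 1 "e1 + e2" "- 1 *s e1"])
        (use mem' ne in auto)
    moreover have "a 3 < a 0"
      by (rule unitarizable_weight_less[OF U pos, of 3 "e1 + \<mu> *s e2" 1 2 e1 "\<mu> *s e2"])
        (use mem' ne in auto)
    moreover have "a 4 < a 0"
      by (rule unitarizable_weight_less[OF U pos, of 4 "e1 + e2" 1 2 e1 e2])
        (use mem' ne4 in auto)
    ultimately show ?C using tr p unfolding all4 by auto
  qed
  show ?thesis using degenerate nondegenerate by blast
qed

end
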